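(* $[\mathcal{R}\mathbf{Txt}\mathbf{Sd}\mathbf{CInd}\mathbf{Ex}_C]_{\mathbf{REC}} \subsetneq [\mathbf{Txt}\mathbf{Sd}\mathbf{CInd}\mathbf{Ex}_C]_{\mathbf{REC}}$.
   Context: Fix an acceptable numbering $(\varphi_e)_{e\in\mathbb{N}}$ of all partial computable functions. A number $e$ is a $C$-index if $\varphi_e$ is total with values in $\{0,1\}$; then $C_e=\{x:\varphi_e(x)=1\}$. $\mathbf{REC}$ is the collection of recursive subsets of $\mathbb{N}$; $\mathcal{P}$ and $\mathcal{R}$ are the partial computable and total computable functions. Fix a pause symbol $\#$. A text is a total function $T:\mathbb{N}\to\mathbb{N}\cup\{\#\}$, $\mathrm{content}(T)=\mathrm{range}(T)\setminus\{\#\}$, $T$ is a text for $L$ if $\mathrm{content}(T)=L$, $T[n]=(T(0),\dots,T(n-1))$. A learner is some $h\in\mathcal{P}$ (finite sets coded as numbers). Set-driven hypothesis sequence: $\mathbf{Sd}(h,T)(i)=h(\mathrm{content}(T[i]))$. Restrictions on a hypothesis sequence $p$ and text $T$: $\mathbf{Ex}_C$: there is $n_0$ with $p(n)=p(n_0)$ for all $n\ge n_0$ and $p(n_0)$ a $C$-index with $C_{p(n_0)}=\mathrm{content}(T)$; $\mathbf{CInd}$: for all $i$, $p(i)$ is a $C$-index. Juxtaposition means conjunction. For $\mathcal{C}\in\{\mathcal{P},\mathcal{R}\}$ (omitted means $\mathcal{P}$), $h\in\mathcal{C}$ $\mathcal{C}\mathbf{Txt}\beta\delta$-learns $L$ iff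 $\delta(\beta(h,T),T)$ holds for every text $T$ for $L$; $[\mathcal{C}\mathbf{Txt}\beta\delta]_{\mathbf{REC}}$ is the set of all classes $\mathcal{L}\subseteq\mathbf{REC}$ for which some $h\in\mathcal{C}$ learns every $L\in\mathcal{L}$. *)

theory Defs
  imports Main "HOL-Library.Nat_Bijection"
begin

text \<open>
  Partial recursive functions are given by Kleene's schemes, evaluated on argument lists.
  Terms carry no arities: a term denotes a \<open>k\<close>-ary partial function by restricting attention to
  argument lists of length \<open>k\<close>. \<open>Zero\<close> is the zero function of every arity; \<open>Succ\<close>, \<open>Proj i\<close> and
  \<open>Prec f g\<close> are undefined on argument lists of unsuitable length.
\<close>

datatype recf =
    Zero
  | Succ
  | Proj nat
  | Comp recf "recf list"
  | Prec recf recf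
  | Mu recf

fun rec_eval :: "recf \<Rightarrow> nat list \<Rightarrow> nat option" where
  "rec_eval Zero xs = Some 0"
| "rec_eval Succ xs = (case xs of [x] \<Rightarrow> Some (Suc x) | _ \<Rightarrow> None)"
| "rec_eval (Proj i) xs = (if i < length xs then Some (xs ! i) else None)"
| "rec_eval (Comp f gs) xs =
     (if \<forall>g \<in> set gs. rec_eval g xs \<noteq> None
      then rec_eval f (map (\<lambda>g. the (rec_eval g xs)) gs)
      else None)"
| "rec_eval (Prec f g) xs =
     (case xs of
        [] \<Rightarrow> None
      | n # ys \<Rightarrow>
          rec_nat (rec_eval f ys) (\<lambda>m r. Option.bind r (\<lambda>y. rec_eval g (m # y # ys))) n)"
| "rec_eval (Mu f) xs =
     (if \<exists>n. rec_eval f (n # xs) = Some 0 \<and> (\<forall>m<n. rec_eval f (m # xs) \<noteq> None)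
      then Some (LEAST n. rec_eval f (n # xs) = Some 0)
      else None)"

definition partial_computable :: "(nat \<rightharpoonup> nat) set" where
  "partial_computable = {\<psi>. \<exists>r. \<forall>x. \<psi> x = rec_eval r [x]}"

definition partial_computable2 :: "(nat \<Rightarrow> nat \<rightharpoonup> nat) set" where
  "partial_computable2 = {\<psi>. \<exists>r. \<forall>x y. \<psi> x y = rec_eval r [x, y]}"

definition total_computable :: "(nat \<rightharpoonup> nat) set" where
  "total_computable = {\<psi> \<in> partial_computable. dom \<psi> = UNIV}"

definition REC :: "nat set set" where
  "REC = {A. (\<lambda>x. Some (of_bool (x \<in> A))) \<in> total_computable}"

text \<open>
  Acceptability in the sense of Rogers: the numbering has a partial computable universal function,
  and every numbering with a partial computable universal function is translated into it by a
  total computable function. Taking \<open>\<psi>\<close> independent of its first argument shows that such a \<open>\<phi>\<close>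
  enumerates all unary partial computable functions.
\<close>

definition acceptable_numbering :: "(nat \<Rightarrow> nat \<rightharpoonup> nat) \<Rightarrow> bool" where
  "acceptable_numbering \<phi> \<longleftrightarrow>
     \<phi> \<in> partial_computable2 \<and>
     (\<forall>\<psi> \<in> partial_computable2. \<exists>t :: nat \<Rightarrow> nat.
        (\<lambda>i. Some (t i)) \<in> total_computable \<and> (\<forall>i. \<psi> i = \<phi> (t i)))"

definition C_index :: "(nat \<Rightarrow> nat \<rightharpoonup> nat) \<Rightarrow> nat \<Rightarrow> bool" where
  "C_index \<phi> e \<longleftrightarrow> (\<forall>x. \<phi> e x \<in> {Some 0, Some 1})"

definition C_set :: "(nat \<Rightarrow> nat \<rightharpoonup> nat) \<Rightarrow> nat \<Rightarrow> nat set" where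
  "C_set \<phi> e = {x. \<phi> e x = Some 1}"

text \<open>In a text, \<open>None\<close> is the pause symbol.\<close>

type_synonym nat_text = "nat \<Rightarrow> nat option"

definition content :: "nat_text \<Rightarrow> nat set" where
  "content T = Option.these (range T)"

definition init_seg :: "nat_text \<Rightarrow> nat \<Rightarrow> nat option list" where
  "init_seg T n = map T [0..<n]"

definition seg_content :: "nat option list \<Rightarrow> nat set" where
  "seg_content \<sigma> = Option.these (set \<sigma>)"

definition text_for :: "nat_text \<Rightarrow> nat set \<Rightarrow> bool" where
  "text_for T L \<longleftrightarrow> content T = L"

text \<open>
  In a hypothesis sequence \<open>p\<close>, \<open>p i = None\<close> means that the learner diverges at stage \<open>i\<close>.
  Finite sets are coded by their canonical indices, i.e. \<open>D\<close> is coded by the sum of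
  \<open>2 ^ x\<close> over \<open>x\<close> in \<open>D\<close>.
\<close>

type_synonym hyp_seq = "nat \<Rightarrow> nat option"

definition Sd :: "(nat \<rightharpoonup> nat) \<Rightarrow> nat_text \<Rightarrow> hyp_seq" where
  "Sd h T = (\<lambda>i. h (set_encode (seg_content (init_seg T i))))"

definition Ex_C :: "(nat \<Rightarrow> nat \<rightharpoonup> nat) \<Rightarrow> hyp_seq \<Rightarrow> nat_text \<Rightarrow> bool" where
  "Ex_C \<phi> p T \<longleftrightarrow>
     (\<exists>n\<^sub>0 e. (\<forall>n\<ge>n\<^sub>0. p n = p n\<^sub>0) \<and> p n\<^sub>0 = Some e \<and> C_index \<phi> e \<and> C_set \<phi> e = content T)"

definition CInd :: "(nat \<Rightarrow> nat \<rightharpoonup> nat) \<Rightarrow> hyp_seq \<Rightarrow> nat_text \<Rightarrow> bool" where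
  "CInd \<phi> p T \<longleftrightarrow> (\<forall>i. \<exists>e. p i = Some e \<and> C_index \<phi> e)"

definition CInd_Ex_C :: "(nat \<Rightarrow> nat \<rightharpoonup> nat) \<Rightarrow> hyp_seq \<Rightarrow> nat_text \<Rightarrow> bool" where
  "CInd_Ex_C \<phi> p T \<longleftrightarrow> CInd \<phi> p T \<and> Ex_C \<phi> p T"

definition Txt_learns ::
    "((nat \<rightharpoonup> nat) \<Rightarrow> nat_text \<Rightarrow> hyp_seq) \<Rightarrow> (hyp_seq \<Rightarrow> nat_text \<Rightarrow> bool) \<Rightarrow> (nat \<rightharpoonup> nat) \<Rightarrow> nat set \<Rightarrow> bool"
  where
  "Txt_learns \<beta> \<delta> h L \<longleftrightarrow> (\<forall>T. text_for T L \<longrightarrow> \<delta> (\<beta> h T) T)"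

definition Txt_REC ::
    "(nat \<rightharpoonup> nat) set \<Rightarrow> ((nat \<rightharpoonup> nat) \<Rightarrow> nat_text \<Rightarrow> hyp_seq) \<Rightarrow> (hyp_seq \<Rightarrow> nat_text \<Rightarrow> bool) \<Rightarrow> nat set set set"
  where
  "Txt_REC \<C> \<beta> \<delta> = {\<L>. \<L> \<subseteq> REC \<and> (\<exists>h \<in> \<C>. \<forall>L \<in> \<L>. Txt_learns \<beta> \<delta> h L)}"

end

theory Submission
  imports Defs
begin

text \<open>
  Against a total learner \<open>h = \<phi> p\<close> build greedily a decidable set \<open>L\<^sub>p\<close> marked by the
  even number \<open>2 * p\<close>: the odd number \<open>2 * s + 1\<close> is added exactly when this makes \<open>h\<close> change
  its mind. If \<open>L\<^sub>p\<close> is infinite, \<open>h\<close> does not converge on it. If \<open>L\<^sub>p\<close> is finite, \<open>h\<close> has the same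
  hypothesis on \<open>L\<^sub>p \<union> {2 * s + 1}\<close> for all large \<open>s\<close>. Take the class of all \<open>L\<^sub>p\<close> with \<open>\<phi> p\<close> total,
  together with the sets \<open>L\<^sub>p \<union> {2 * s + 1}\<close> for finite \<open>L\<^sub>p\<close>. A partial learner reads
  \<open>p\<close> off the marker and simulates \<open>\<phi> p\<close>, which may be partial on irrelevant data: it
  conjectures \<open>L\<^sub>p\<close> as long as the data lie in \<open>L\<^sub>p\<close>, and exactly the data otherwise.
\<close>

section \<open>Some recursive functions\<close>

fun r_const :: "nat \<Rightarrow> recf" where
  "r_const 0 = Zero"
| "r_const (Suc k) = Comp Succ [r_const k]"

lemma r_const [simp]: "rec_eval (r_const k) xs = Some k"
  by (induction k) auto

definition "r_add = Prec (Proj 0) (Comp Succ [Proj 1])"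

lemma r_add [simp]: "rec_eval r_add [m, n] = Some (m + n)"
  unfolding r_add_def by (induction m) auto

definition "r_mult = Prec Zero (Comp r_add [Proj 1, Proj 2])"

lemma r_mult [simp]: "rec_eval r_mult [m, n] = Some (m * n)"
  unfolding r_mult_def by (induction m) auto

definition "r_pow2 = Prec (r_const 1) (Comp r_add [Proj 1, Proj 1])"

lemma r_pow2 [simp]: "rec_eval r_pow2 [n] = Some (2 ^ n)"
  unfolding r_pow2_def by (induction n) auto

definition "r_pred = Prec Zero (Proj 0)"

lemma r_pred [simp]: "rec_eval r_pred [n] = Some (n - 1)"
  unfolding r_pred_def by (induction n) auto

text \<open>\<open>Prec\<close> recurses on its first argument, hence the swap: the subtrahend
  counts the applications of the predecessor.\<close>

definition "r_minus = Comp (Prec (Proj 0) (Comp r_pred [Proj 1])) [Proj 1, Proj 0]"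

lemma r_minus [simp]: "rec_eval r_minus [m, n] = Some (m - n)"
  unfolding r_minus_def by (induction n) auto

definition "r_sgn = Prec Zero (r_const 1)"

lemma r_sgn [simp]: "rec_eval r_sgn [n] = Some (of_bool (n \<noteq> 0))"
  unfolding r_sgn_def by (induction n) auto

definition "r_neq = Comp r_sgn [Comp r_add [r_minus, Comp r_minus [Proj 1, Proj 0]]]"

lemma r_neq [simp]: "rec_eval r_neq [m, n] = Some (of_bool (m \<noteq> n))"
  unfolding r_neq_def by auto

definition "r_mod2 = Prec Zero (Comp r_minus [r_const 1, Proj 1])"

lemma r_mod2 [simp]: "rec_eval r_mod2 [n] = Some (n mod 2)"
  unfolding r_mod2_def by (induction n) (auto, presburger)

definition "r_div2 = Prec Zero (Comp r_add [Proj 1, Comp r_mod2 [Proj 0]])"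

lemma r_div2 [simp]: "rec_eval r_div2 [n] = Some (n div 2)"
  unfolding r_div2_def by (induction n) (auto, presburger)

definition "r_shift = Prec (Proj 0) (Comp r_div2 [Proj 1])"

lemma r_shift [simp]: "rec_eval r_shift [k, n] = Some (n div 2 ^ k)"
  unfolding r_shift_def by (induction k) (auto simp: div_mult2_eq[symmetric] mult.commute)

definition "r_bit = Comp r_mod2 [r_shift]"

lemma r_bit [simp]: "rec_eval r_bit [x, n] = Some (of_bool (x \<in> set_decode n))"
  unfolding r_bit_def by (auto simp: set_decode_def odd_iff_mod_2_eq_one)

section \<open>The diagonal set\<close>

fun stage :: "(nat \<Rightarrow> nat) \<Rightarrow> nat \<Rightarrow> nat \<Rightarrow> nat set" where
  "stage h p 0 = {2 * p}"
| "stage h p (Suc s) =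
     (if h (set_encode (insert (2 * s + 1) (stage h p s))) \<noteq> h (set_encode (stage h p s))
      then insert (2 * s + 1) (stage h p s) else stage h p s)"

definition diag :: "(nat \<Rightarrow> nat) \<Rightarrow> nat \<Rightarrow> nat set" where
  "diag h p = (\<Union>s. stage h p s)"

lemma finite_stage [simp]: "finite (stage h p s)"
  by (induction s) auto

lemma stage_mono: "s \<le> t \<Longrightarrow> stage h p s \<subseteq> stage h p t"
  by (rule lift_Suc_mono_le) auto

lemma stage_cases: "x \<in> stage h p s \<Longrightarrow> x = 2 * p \<or> (\<exists>i<s. x = 2 * i + 1)"
  by (induction s) (auto split: if_splits dest: less_SucI)

lemma stage_subset_diag: "stage h p s \<subseteq> diag h p"
  by (auto simp: diag_def)

lemma marker_in_diag: "2 * p \<in> diag h p"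
  using stage_subset_diag[of h p 0] by simp

lemma stage_fresh: "2 * s + 1 \<notin> stage h p s"
  using stage_cases[of "2 * s + 1" h p s] by auto presburger

lemma even_in_diag: "2 * k \<in> diag h p \<Longrightarrow> k = p"
  unfolding diag_def by (auto dest!: stage_cases) presburger

lemma odd_in_diag_iff: "2 * s + 1 \<in> diag h p \<longleftrightarrow> 2 * s + 1 \<in> stage h p (Suc s)"
proof
  assume "2 * s + 1 \<in> diag h p"
  then obtain t where t: "2 * s + 1 \<in> stage h p t" by (auto simp: diag_def)
  then show "2 * s + 1 \<in> stage h p (Suc s)"
  proof (induction t)
    case 0
    then show ?case by (simp, presburger)
  next
    case (Suc t)
    then show ?case by (cases "t = s") (auto split: if_splits)
  qed
qed (use stage_subset_diag in blast)

text \<open>The marker is present from stage 0 on, and \<open>2 * i + 1\<close> is settled at stage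
  \<open>Suc i\<close>, which is at most \<open>Suc x\<close>. So a bounded computation decides
  membership.\<close>

lemma in_diag_iff: "x \<in> diag h p \<longleftrightarrow> x \<in> stage h p (Suc x)"
proof
  assume x: "x \<in> diag h p"
  then obtain t where "x \<in> stage h p t" by (auto simp: diag_def)
  then consider "x = 2 * p" | i where "x = 2 * i + 1" using stage_cases by blast
  then show "x \<in> stage h p (Suc x)"
  proof cases
    case 1
    then show ?thesis using stage_mono[of 0 "Suc x" h p] by auto
  next
    case 2
    then show ?thesis using x odd_in_diag_iff[of i h p] stage_mono[of "Suc i" "Suc x" h p] by auto
  qed
qed (use stage_subset_diag in blast)

text \<open>By \<open>stage_fresh\<close> the inserted number is new, so insertion adds a power of
  two to the code. On codes, \<open>stage\<close> thus becomes a primitive recursion relative to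
  \<open>h\<close>.\<close>

lemma set_encode_stage_Suc:
  "set_encode (stage h p (Suc s)) =
     set_encode (stage h p s) + 2 ^ (2 * s + 1) *
       of_bool (h (set_encode (stage h p s) + 2 ^ (2 * s + 1)) \<noteq> h (set_encode (stage h p s)))"
  using stage_fresh[of s h p] by (auto simp: set_encode_insert add.commute)

section \<open>Recursiveness of the diagonal set\<close>

definition r_stage :: "recf \<Rightarrow> recf" where
  "r_stage u =
     (let e = Comp r_pow2 [Comp Succ [Comp r_mult [r_const 2, Proj 0]]];
          c = Comp r_add [Proj 1, e]
      in Prec (Comp r_pow2 [Comp r_mult [r_const 2, Proj 0]])
           (Comp r_add [Proj 1, Comp r_mult [e,
              Comp r_neq [Comp u [Proj 2, c], Comp u [Proj 2, Proj 1]]]]))"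

text \<open>Totality is required of row \<open>p\<close> only: \<open>u\<close> will be the
  universal function, which may diverge on other rows.\<close>

lemma r_stage:
  assumes "\<And>n. rec_eval u [p, n] = Some (h n)"
  shows "rec_eval (r_stage u) [s, p] = Some (set_encode (stage h p s))"
proof (induction s)
  case 0
  then show ?case by (simp add: r_stage_def Let_def set_encode_def)
next
  case (Suc s)
  then show ?case
    unfolding set_encode_stage_Suc by (simp add: r_stage_def Let_def assms)
qed

definition r_diag :: "recf \<Rightarrow> recf" where
  "r_diag u = Comp r_bit [Proj 1, Comp (r_stage u) [Comp Succ [Proj 1], Proj 0]]"

lemma r_diag:
  assumes "\<And>n. rec_eval u [p, n] = Some (h n)"
  shows "rec_eval (r_diag u) [p, x] = Some (of_bool (x \<in> diag h p))"
  by (simp add: r_diag_def r_stage[of u p h, OF assms] set_encode_inverse in_diag_iff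
      del: stage.simps)

text \<open>
  Even indices denote diagonal sets, odd ones finite sets. The primitive recursion acts as
  a conditional which evaluates its second branch only when it is selected.
\<close>

definition r_family :: "recf \<Rightarrow> recf" where
  "r_family u =
     Comp (Prec (Comp r_bit [Proj 1, Comp r_div2 [Proj 0]])
                (Comp (r_diag u) [Comp r_div2 [Proj 2], Proj 3]))
       [Comp r_minus [r_const 1, Comp r_mod2 [Proj 0]], Proj 0, Proj 1]"

text \<open>An odd index makes the recursion counter 0, so \<open>u\<close> is never evaluated and
  cannot cause divergence.\<close>

lemma r_family_finite:
  "rec_eval (r_family u) [2 * n + 1, x] = Some (of_bool (x \<in> set_decode n))"
  by (simp add: r_family_def)

lemma r_family_diag:
  assumes "\<And>n. rec_eval u [p, n] = Some (h n)"
  shows "rec_eval (r_family u) [2 * p, x] = Some (of_bool (x \<in> diag h p))"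
  by (simp add: r_family_def r_diag[of u p h, OF assms])

section \<open>The partial learner\<close>

text \<open>The summand \<open>Suc k\<close> reserves the value 0 for data without a marker. The
  bound \<open>n\<close> suffices because elements of \<open>set_decode n\<close> are below
  \<open>n\<close>.\<close>

definition marker :: "nat \<Rightarrow> nat" where
  "marker n = (\<Sum>k<n. of_bool (2 * k \<in> set_decode n) * Suc k)"

definition r_marker :: recf where
  "r_marker = Comp (Prec Zero (Comp r_add [Proj 1, Comp r_mult
      [Comp r_bit [Comp r_mult [r_const 2, Proj 0], Proj 2], Comp Succ [Proj 0]]]))
    [Proj 0, Proj 0]"

lemma r_marker [simp]: "rec_eval r_marker [n] = Some (marker n)"
proof -
  have "rec_eval (Prec Zero (Comp r_add [Proj 1, Comp r_mult
      [Comp r_bit [Comp r_mult [r_const 2, Proj 0], Proj 2], Comp Succ [Proj 0]]])) [k, n]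
    = Some (\<Sum>k<k. of_bool (2 * k \<in> set_decode n) * Suc k)" for k
    by (induction k) auto
  then show ?thesis by (simp add: r_marker_def marker_def del: rec_eval.simps(5))
qed

text \<open>If \<open>n \<le> x\<close> then \<open>n < 2 ^ x\<close>, so bit \<open>x\<close> of
  \<open>n\<close> is 0.\<close>

lemma set_decode_less: "x \<in> set_decode n \<Longrightarrow> x < n"
proof (rule ccontr)
  assume "x \<in> set_decode n" "\<not> x < n"
  moreover from this have "n < 2 ^ x"
    using less_exp[of x] by linarith
  ultimately show False by (simp add: set_decode_def)
qed

lemma marker_none: "(\<And>k. 2 * k \<notin> set_decode n) \<Longrightarrow> marker n = 0"
  by (simp add: marker_def)

lemma marker_unique:
  assumes "\<And>k. 2 * k \<in> set_decode n \<longleftrightarrow> k = p"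
  shows "marker n = Suc p"
proof -
  have "p < n" using set_decode_less[of "2 * p" n] assms by auto
  have "marker n = (\<Sum>k<n. if k = p then Suc k else 0)"
    unfolding marker_def assms by (rule sum.cong) auto
  with \<open>p < n\<close> show ?thesis by simp
qed

definition r_outside :: "recf \<Rightarrow> recf" where
  "r_outside u = Prec Zero (Comp r_add [Proj 1, Comp r_mult
      [Comp r_bit [Proj 0, Proj 2],
       Comp r_minus [r_const 1, Comp (r_diag u) [Proj 3, Proj 0]]]])"

lemma r_outside:
  assumes "\<And>n. rec_eval u [p, n] = Some (h n)"
  shows "rec_eval (r_outside u) [k, n, p] =
    Some (\<Sum>x<k. of_bool (x \<in> set_decode n \<and> x \<notin> diag h p))"
  by (induction k) (auto simp: r_outside_def r_diag[of u p h, OF assms])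

lemma outside_zero_iff:
  "(\<Sum>x<n. of_bool (x \<in> set_decode n \<and> x \<notin> A)) = (0::nat) \<longleftrightarrow> set_decode n \<subseteq> A"
  by (auto dest: set_decode_less)

text \<open>The value is an index into \<open>r_family\<close>. For unmarked data the counter of the
  outer \<open>Prec\<close> is 0, so \<open>u\<close> is not evaluated while \<open>p\<close> is
  unknown; divergence there would violate \<open>CInd\<close>. The flag \<open>b\<close> is 1 if
  some datum lies outside the diagonal set.\<close>

definition r_select :: "recf \<Rightarrow> recf" where
  "r_select u =
     (let p = Comp r_pred [Comp r_marker [Proj 2]];
          b = Comp r_sgn [Comp (r_outside u) [Proj 2, Proj 2, p]]
      in Comp (Prec (Comp Succ [Comp r_mult [r_const 2, Proj 0]])
           (Comp r_add [Comp r_mult [b, Proj 1],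
              Comp r_mult [Comp r_minus [r_const 1, b], Comp r_mult [r_const 2, p]]]))
         [Comp r_sgn [r_marker], Proj 0])"

lemma r_select_unmarked:
  "(\<And>k. 2 * k \<notin> set_decode n) \<Longrightarrow> rec_eval (r_select u) [n] = Some (2 * n + 1)"
  by (simp add: r_select_def Let_def marker_none)

lemma r_select_marked:
  assumes "\<And>n. rec_eval u [p, n] = Some (h n)"
    and "\<And>k. 2 * k \<in> set_decode n \<longleftrightarrow> k = p"
  shows "rec_eval (r_select u) [n] =
    Some (if set_decode n \<subseteq> diag h p then 2 * p else 2 * n + 1)"
proof -
  have "rec_eval (r_outside u) [n, n, p] =
      Some (\<Sum>x<n. of_bool (x \<in> set_decode n \<and> x \<notin> diag h p))"
    by (rule r_outside) (rule assms(1))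
  then show ?thesis
    unfolding outside_zero_iff[symmetric]
    by (simp add: r_select_def Let_def marker_unique[OF assms(2)] del: sum_eq_0_iff)
qed

section \<open>Set-driven learning\<close>

lemma seg_content_init_seg: "seg_content (init_seg T n) = Option.these (T ` {..<n})"
  by (simp add: seg_content_def init_seg_def atLeast0LessThan)

lemma finite_seg_content [simp]: "finite (seg_content (init_seg T n))"
  by (simp add: seg_content_init_seg Option.these_def)

lemma seg_content_subset_content: "seg_content (init_seg T n) \<subseteq> content T"
  by (auto simp: seg_content_init_seg content_def Option.these_def)

lemma seg_content_eventually_contains:
  assumes "finite D" and "D \<subseteq> content T"
  shows "\<exists>n0. \<forall>n\<ge>n0. D \<subseteq> seg_content (init_seg T n)"
  using assms
proof (induction D)
  case (insert x D)
  then obtain n0 where n0: "\<forall>n\<ge>n0. D \<subseteq> seg_content (init_seg T n)" by auto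
  from insert obtain i where "T i = Some x"
    by (auto simp: content_def in_these_eq)
  then have "x \<in> seg_content (init_seg T n)" if "n \<ge> Suc i" for n
    using that by (auto simp: seg_content_init_seg in_these_eq intro!: image_eqI[of _ T i])
  with n0 show ?case by (intro exI[of _ "max n0 (Suc i)"]) auto
qed auto

text \<open>Reduces learning from texts to finite subsets of \<open>L\<close>: \<open>D0\<close>
  acts as a locking set, and every text eventually shows all of it.\<close>

lemma Sd_learnsI:
  assumes ind: "\<And>D. finite D \<Longrightarrow> D \<subseteq> L \<Longrightarrow> \<exists>e. g (set_encode D) = Some e \<and> C_index \<phi> e"
    and "finite D0" "D0 \<subseteq> L"
    and conv: "\<And>D. finite D \<Longrightarrow> D0 \<subseteq> D \<Longrightarrow> D \<subseteq> L \<Longrightarrow> g (set_encode D) = Some e"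
    and "C_set \<phi> e = L"
  shows "Txt_learns Sd (CInd_Ex_C \<phi>) g L"
  unfolding Txt_learns_def
proof (intro allI impI)
  fix T assume "text_for T L"
  then have L: "content T = L" by (simp add: text_for_def)
  obtain n0 where n0: "\<And>n. n \<ge> n0 \<Longrightarrow> D0 \<subseteq> seg_content (init_seg T n)"
    using seg_content_eventually_contains[of D0 T] assms(2,3) L by blast
  have "Sd g T n = Some e" if "n \<ge> n0" for n
    using conv[of "seg_content (init_seg T n)"] n0[OF that] seg_content_subset_content[of T n] L
    by (simp add: Sd_def)
  moreover have "C_index \<phi> e"
    using ind[of D0] conv[of D0] assms(2,3) by auto
  ultimately have "Ex_C \<phi> (Sd g T) T"
    unfolding Ex_C_def using assms(5) L by (intro exI[of _ n0] exI[of _ e]) simp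
  moreover have "CInd \<phi> (Sd g T) T"
    unfolding CInd_def Sd_def using ind seg_content_subset_content[of T] L by simp
  ultimately show "CInd_Ex_C \<phi> (Sd g T) T" by (simp add: CInd_Ex_C_def)
qed

lemma ex_text: "\<exists>T. text_for T L"
proof -
  have "text_for (\<lambda>x. if x \<in> L then Some x else None) L"
    by (auto simp: text_for_def content_def in_these_eq image_iff split: if_splits)
  then show ?thesis by blast
qed

text \<open>A text for a finite set has shown all of it from some point on, so the limit hypothesis
  is the one on the full set.\<close>

lemma Sd_learns_finiteD:
  assumes "Txt_learns Sd (CInd_Ex_C \<phi>) g D" and "finite D"
  obtains e where "g (set_encode D) = Some e" "C_set \<phi> e = D"
proof -
  obtain T where T: "text_for T D" using ex_text by blast
  then have D: "content T = D" by (simp add: text_for_def)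
  from T assms(1) have "Ex_C \<phi> (Sd g T) T" by (simp add: Txt_learns_def CInd_Ex_C_def)
  then obtain n0 e where e: "\<forall>n\<ge>n0. Sd g T n = Sd g T n0" "Sd g T n0 = Some e" "C_set \<phi> e = D"
    unfolding Ex_C_def D by blast
  obtain n1 where n1: "\<And>n. n \<ge> n1 \<Longrightarrow> D \<subseteq> seg_content (init_seg T n)"
    using seg_content_eventually_contains[of D T] assms(2) D by blast
  have "seg_content (init_seg T (max n0 n1)) = D"
    using n1[of "max n0 n1"] seg_content_subset_content[of T "max n0 n1"] D by auto
  then have "g (set_encode D) = Sd g T (max n0 n1)" by (simp add: Sd_def)
  also have "\<dots> = Some e" using e(1,2) by simp
  finally show ?thesis using e(3) that by blast
qed

section \<open>The separation\<close>

definition diag_class :: "(nat \<Rightarrow> nat \<rightharpoonup> nat) \<Rightarrow> nat set set" where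
  "diag_class \<phi> = {L. \<exists>p h. (\<forall>n. \<phi> p n = Some (h n)) \<and>
     (L = diag h p \<or> finite (diag h p) \<and> (\<exists>s. L = insert (2 * s + 1) (diag h p)))}"

section \<open>Failure of total learners on the diagonal class\<close>

lemma diag_class_not_learnable:
  assumes total: "\<And>n. \<phi> p n = Some (h n)"
    and learns: "\<And>L. L \<in> diag_class \<phi> \<Longrightarrow> Txt_learns Sd (CInd_Ex_C \<phi>) (\<phi> p) L"
  shows False
proof (cases "finite (diag h p)")
  case True
  obtain N where N: "\<And>s. s \<ge> N \<Longrightarrow> 2 * s + 1 \<notin> diag h p"
  proof -
    obtain N where "\<forall>x\<in>diag h p. x < N" using True by (auto simp: finite_nat_set_iff_bounded)
    then show ?thesis by (intro that[of N]) force
  qed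
  \<comment> \<open>No number enters from stage \<open>N\<close> on, so stage \<open>s\<close> is
    already all of \<open>diag h p\<close>, and the rejection of \<open>2 * s + 1\<close> means that
    \<open>h\<close> keeps its hypothesis.\<close>
  have same: "h (set_encode (insert (2 * s + 1) (diag h p))) = h (set_encode (diag h p))"
    if "s \<ge> N" for s
  proof -
    have "x \<in> stage h p s" if "x \<in> diag h p" for x
    proof -
      from that obtain t where t: "x \<in> stage h p t" by (auto simp: diag_def)
      then consider "x = 2 * p" | i where "x = 2 * i + 1" using stage_cases by blast
      then show ?thesis
      proof cases
        case 1
        then show ?thesis using stage_mono[of 0 s h p] by auto
      next
        case 2
        with that N have "i < s" using \<open>s \<ge> N\<close> by (meson not_le order_trans)
        then show ?thesis
          using 2 that odd_in_diag_iff[of i h p] stage_mono[of "Suc i" s h p] by auto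
      qed
    qed
    then have "stage h p s = diag h p" using stage_subset_diag by blast
    with N[OF that] odd_in_diag_iff[of s h p] show ?thesis by (auto split: if_splits)
  qed
  have "insert (2 * s + 1) (diag h p) \<in> diag_class \<phi>" for s
    using True total by (auto simp: diag_class_def)
  then have "C_set \<phi> (h (set_encode (insert (2 * s + 1) (diag h p)))) = insert (2 * s + 1) (diag h p)"
    for s
    using Sd_learns_finiteD[OF learns, of "insert (2 * s + 1) (diag h p)"] True total by auto
  \<comment> \<open>Both sets receive the hypothesis of \<open>diag h p\<close>, but one index
    denotes only one set.\<close>
  from this[of N] this[of "Suc N"]
  have "insert (2 * N + 1) (diag h p) = insert (2 * Suc N + 1) (diag h p)"
    using same[of N] same[of "Suc N"] by simp
  moreover have "2 * N + 1 \<notin> insert (2 * Suc N + 1) (diag h p)" using N[of N] by simp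
  ultimately show False by blast
next
  case False
  \<comment> \<open>The marker comes first and \<open>2 * s + 1\<close>, or a pause if it was
    rejected, stands at position \<open>Suc s\<close>. The learner therefore sees exactly the
    successive stages.\<close>
  define T where "T i = (case i of 0 \<Rightarrow> Some (2 * p)
     | Suc s \<Rightarrow> if 2 * s + 1 \<in> diag h p then Some (2 * s + 1) else None)" for i
  have seg: "seg_content (init_seg T (Suc s)) = stage h p s" for s
  proof (induction s)
    case 0
    then show ?case by (simp add: seg_content_init_seg lessThan_Suc T_def)
  next
    case (Suc s)
    have "seg_content (init_seg T (Suc (Suc s))) =
        Option.these {T (Suc s)} \<union> seg_content (init_seg T (Suc s))"
      unfolding seg_content_init_seg lessThan_Suc[of "Suc s"] by (auto simp: in_these_eq)
    also have "\<dots> = Option.these {T (Suc s)} \<union> stage h p s" by (simp only: Suc)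
    also have "\<dots> = stage h p (Suc s)"
      using stage_fresh[of s h p] odd_in_diag_iff[of s h p]
      by (auto simp: T_def in_these_eq split: if_splits)
    finally show ?case .
  qed
  have "range T = (\<Union>s. T ` {..<Suc s})" by blast
  then have "content T = (\<Union>s. seg_content (init_seg T (Suc s)))"
    unfolding content_def seg_content_init_seg
    by (simp only: set_eq_iff in_these_eq UN_iff) simp
  then have "text_for T (diag h p)" by (simp only: text_for_def seg diag_def)
  moreover have "diag h p \<in> diag_class \<phi>" using total by (auto simp: diag_class_def)
  ultimately have "Ex_C \<phi> (Sd (\<phi> p) T) T"
    using learns by (simp add: Txt_learns_def CInd_Ex_C_def)
  then obtain n0 where n0: "\<And>n. n \<ge> n0 \<Longrightarrow> Sd (\<phi> p) T n = Sd (\<phi> p) T n0"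
    unfolding Ex_C_def by blast
  have const: "h (set_encode (stage h p s)) = h (set_encode (stage h p n0))" if "s \<ge> n0" for s
    using n0[of "Suc s"] n0[of "Suc n0"] that by (simp add: Sd_def seg total)
  \<comment> \<open>An insertion after stage \<open>n0\<close> would be a mind change, which
    \<open>const\<close> excludes; so the stages stop growing, against infinity of
    \<open>diag h p\<close>.\<close>
  have "stage h p s \<subseteq> stage h p n0" for s
  proof (induction s)
    case 0
    then show ?case using stage_mono[of 0 n0] by simp
  next
    case (Suc s)
    show ?case
    proof (cases "s \<ge> n0")
      case True
      then have "stage h p (Suc s) = stage h p s"
        using const[of s] const[of "Suc s"] by (auto split: if_splits)
      with Suc show ?thesis by simp
    next
      case False
      then show ?thesis by (intro stage_mono) simp
    qed
  qed
  then have "diag h p \<subseteq> stage h p n0" by (auto simp: diag_def)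
  with False show False using finite_subset[OF _ finite_stage] by blast
qed

section \<open>Recursiveness of learned sets\<close>

lemma C_set_recursive:
  assumes "\<phi> \<in> partial_computable2" and "C_index \<phi> e"
  shows "C_set \<phi> e \<in> REC"
proof -
  obtain u where u: "\<And>x y. \<phi> x y = rec_eval u [x, y]"
    using assms(1) by (auto simp: partial_computable2_def)
  have "Some (of_bool (x \<in> C_set \<phi> e)) = rec_eval (Comp u [r_const e, Proj 0]) [x]" for x
    using assms(2) by (auto simp: C_index_def C_set_def u dest: spec[of _ x])
  then show ?thesis
    unfolding REC_def total_computable_def partial_computable_def dom_def by blast
qed

text \<open>The limit hypothesis on any one text is a \<open>C_index\<close> of \<open>L\<close>.
  This will place the diagonal class inside \<open>REC\<close>.\<close>

lemma Sd_learnable_recursive: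
  assumes "\<phi> \<in> partial_computable2" and "Txt_learns Sd (CInd_Ex_C \<phi>) g L"
  shows "L \<in> REC"
proof -
  obtain T where T: "text_for T L" using ex_text by blast
  with assms(2) have "Ex_C \<phi> (Sd g T) T" by (simp add: Txt_learns_def CInd_Ex_C_def)
  then obtain e where "C_index \<phi> e" "C_set \<phi> e = L"
    using T by (auto simp: Ex_C_def text_for_def)
  then show ?thesis using C_set_recursive[OF assms(1)] by blast
qed

section \<open>A partial learner for the diagonal class\<close>

lemma acceptable_translation:
  assumes "acceptable_numbering \<phi>" and "\<psi> \<in> partial_computable2"
  obtains t where "(\<lambda>i. Some (t i)) \<in> total_computable" and "\<And>i. \<psi> i = \<phi> (t i)"
  using assms by (auto simp: acceptable_numbering_def)

lemma diag_class_learnable: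
  assumes "acceptable_numbering \<phi>"
  obtains g where "g \<in> partial_computable"
    and "\<And>L. L \<in> diag_class \<phi> \<Longrightarrow> Txt_learns Sd (CInd_Ex_C \<phi>) g L"
proof -
  obtain u where u: "\<And>x y. \<phi> x y = rec_eval u [x, y]"
    using assms by (auto simp: acceptable_numbering_def partial_computable2_def)
  have family: "(\<lambda>x y. rec_eval (r_family u) [x, y]) \<in> partial_computable2"
    by (auto simp: partial_computable2_def)
  \<comment> \<open>Acceptability translates the indices of \<open>r_family\<close>, which
    \<open>r_select\<close> outputs, into indices of \<open>\<phi>\<close>.\<close>
  obtain t where "(\<lambda>i. Some (t i)) \<in> total_computable"
    and t: "\<And>i. (\<lambda>y. rec_eval (r_family u) [i, y]) = \<phi> (t i)"
    by (rule acceptable_translation[OF assms family]) blast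
  then obtain rt where rt: "\<And>i. rec_eval rt [i] = Some (t i)"
    by (auto simp: total_computable_def partial_computable_def)
  define g where "g n = rec_eval (Comp rt [r_select u]) [n]" for n
  have g: "g n = Some (t m)" if "rec_eval (r_select u) [n] = Some m" for n m
    using that by (simp add: g_def rt)
  have eq: "\<phi> (t i) y = rec_eval (r_family u) [i, y]" for i y
    using t[of i] by metis
  have fin: "C_index \<phi> (t (2 * n + 1))" "C_set \<phi> (t (2 * n + 1)) = set_decode n" for n
    by (simp_all add: C_index_def C_set_def eq r_family_finite del: One_nat_def)
  show ?thesis
  proof (rule that[of g])
    show "g \<in> partial_computable" unfolding partial_computable_def g_def by blast
    fix L assume "L \<in> diag_class \<phi>"
    then obtain p h where total: "\<And>n. rec_eval u [p, n] = Some (h n)"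
      and L: "L = diag h p \<or> finite (diag h p) \<and> (\<exists>s. L = insert (2 * s + 1) (diag h p))"
      by (auto simp: diag_class_def u)
    have dia: "C_index \<phi> (t (2 * p))" "C_set \<phi> (t (2 * p)) = diag h p"
      by (simp_all add: C_index_def C_set_def eq r_family_diag[of u p h, OF total])
    \<comment> \<open>The added number is odd, so the marker is the only even element and any data
      from \<open>L\<close> containing it reveal \<open>p\<close>.\<close>
    have even_L: "k = p" if "2 * k \<in> L" for k
    proof -
      have "2 * k \<noteq> 2 * s + 1" for s by presburger
      then show ?thesis using that L even_in_diag[of k h p] by auto
    qed
    have marked: "g (set_encode D) =
        Some (t (if D \<subseteq> diag h p then 2 * p else 2 * set_encode D + 1))"
      if "finite D" "D \<subseteq> L" "2 * p \<in> D" for D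
    proof -
      have "2 * k \<in> set_decode (set_encode D) \<longleftrightarrow> k = p" for k
        using that even_L by (auto simp: set_encode_inverse)
      from g[OF r_select_marked[OF total this]] show ?thesis
        using that(1) by (simp only: set_encode_inverse)
    qed
    have unmarked: "g (set_encode D) = Some (t (2 * set_encode D + 1))"
      if "finite D" "D \<subseteq> L" "2 * p \<notin> D" for D
    proof -
      have "2 * k \<notin> set_decode (set_encode D)" for k
        using that even_L[of k] by (auto simp: set_encode_inverse)
      from g[OF r_select_unmarked[OF this]] show ?thesis .
    qed
    have ind: "\<exists>e. g (set_encode D) = Some e \<and> C_index \<phi> e" if "finite D" "D \<subseteq> L" for D
      using marked[OF that] unmarked[OF that] fin dia by (cases "2 * p \<in> D") auto
    show "Txt_learns Sd (CInd_Ex_C \<phi>) g L"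
    proof (cases "L = diag h p")
      case True
      show ?thesis
      \<comment> \<open>Once the marker is seen, all data stay inside \<open>diag h p\<close>, so
        the conjecture is final.\<close>
      proof (rule Sd_learnsI[where ?D0.0 = "{2 * p}" and e = "t (2 * p)"])
        show "g (set_encode D) = Some (t (2 * p))"
          if "finite D" "{2 * p} \<subseteq> D" "D \<subseteq> L" for D
          using marked[of D] that True by auto
      qed (use True ind dia marker_in_diag[of p h] in auto)
    next
      case False
      \<comment> \<open>If the added number already lay in \<open>diag h p\<close>, then
        \<open>L\<close> would be \<open>diag h p\<close>, the previous case. So \<open>L\<close>
        has an element outside.\<close>
      then have L': "finite L" "2 * p \<in> L" "\<not> L \<subseteq> diag h p"
        using L marker_in_diag[of p h] by auto
      show ?thesis
      \<comment> \<open>As \<open>L\<close> is finite, the whole of \<open>L\<close> serves as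
        locking set; on it the learner conjectures exactly the data.\<close>
      proof (rule Sd_learnsI[where ?D0.0 = L and e = "t (2 * set_encode L + 1)"])
        show "g (set_encode D) = Some (t (2 * set_encode L + 1))"
          if "finite D" "L \<subseteq> D" "D \<subseteq> L" for D
        proof -
          have "D = L" using that by blast
          with marked[of L] L' show ?thesis by simp
        qed
        show "C_set \<phi> (t (2 * set_encode L + 1)) = L"
          using fin(2)[of "set_encode L"] L'(1) by (simp only: set_encode_inverse)
      qed (use L' ind in auto)
    qed
  qed
qed

theorem theorem5:
  fixes \<phi> :: "nat \<Rightarrow> nat \<rightharpoonup> nat"
  assumes "acceptable_numbering \<phi>"
  shows "Txt_REC total_computable Sd (CInd_Ex_C \<phi>) \<subset> Txt_REC partial_computable Sd (CInd_Ex_C \<phi>)"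
proof
  show "Txt_REC total_computable Sd (CInd_Ex_C \<phi>) \<subseteq> Txt_REC partial_computable Sd (CInd_Ex_C \<phi>)"
    by (auto simp: Txt_REC_def total_computable_def)
  have universal: "\<phi> \<in> partial_computable2"
    using assms by (simp add: acceptable_numbering_def)
  obtain g where "g \<in> partial_computable"
    and "\<And>L. L \<in> diag_class \<phi> \<Longrightarrow> Txt_learns Sd (CInd_Ex_C \<phi>) g L"
    using diag_class_learnable[OF assms] by blast
  moreover from this have "diag_class \<phi> \<subseteq> REC"
    using Sd_learnable_recursive[OF universal] by blast
  ultimately have "diag_class \<phi> \<in> Txt_REC partial_computable Sd (CInd_Ex_C \<phi>)"
    by (auto simp: Txt_REC_def)
  moreover have "diag_class \<phi> \<notin> Txt_REC total_computable Sd (CInd_Ex_C \<phi>)"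
  proof
    assume "diag_class \<phi> \<in> Txt_REC total_computable Sd (CInd_Ex_C \<phi>)"
    then obtain f where f: "f \<in> total_computable"
      and learns: "\<And>L. L \<in> diag_class \<phi> \<Longrightarrow> Txt_learns Sd (CInd_Ex_C \<phi>) f L"
      by (auto simp: Txt_REC_def)
    obtain r where r: "\<And>x. f x = rec_eval r [x]"
      using f by (auto simp: total_computable_def partial_computable_def)
    have f_def: "f n = Some (the (f n))" for n
      using f by (cases "f n") (auto simp: total_computable_def)
    have "f y = rec_eval (Comp r [Proj 1]) [x, y]" for x y
      using f_def[of y] by (simp add: r)
    \<comment> \<open>Translating the numbering that is constantly \<open>f\<close> yields an index
      \<open>p\<close> of \<open>f\<close>; the set built from this \<open>p\<close> defeats
      \<open>f\<close>.\<close>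
    then have "(\<lambda>x. f) \<in> partial_computable2"
      unfolding partial_computable2_def by blast
    then obtain t where "\<And>i::nat. f = \<phi> (t i)"
      by (rule acceptable_translation[OF assms]) blast
    then obtain p where "f = \<phi> p" by blast
    then show False
      using diag_class_not_learnable[of \<phi> p "\<lambda>n. the (f n)"] f_def learns by auto
  qed
  ultimately show "Txt_REC total_computable Sd (CInd_Ex_C \<phi>) \<noteq> Txt_REC partial_computable Sd (CInd_Ex_C \<phi>)"
    by blast
qed

end
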